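(* The algorithm Convex2Partition is correct: for every input graph $G$ of order $n \ge 2$, it returns a $\Delta$-convex $2$-partition of $G$ if one exists, and it returns the empty set otherwise.
   Context: Graphs are finite, simple and undirected. A triangle of $G$ is a set of three pairwise adjacent vertices. A set $S \subseteq V(G)$ is $\Delta$-convex if there is no vertex $w \in V(G)\setminus S$ that forms a triangle with two vertices of $S$. A $\Delta$-convex $2$-partition of $G$ is a family of two disjoint non-empty $\Delta$-convex sets of $G$ whose union is $V(G)$. A vertex $u$ of $G$ is $\Delta$-extreme if $V(G)\setminus\{u\}$ is $\Delta$-convex; equivalently, if $u$ belongs to no triangle of $G$. Algorithm Convex2Partition. Input: a graph $G$ of order $n \ge 2$. (1) For each $v \in V(G)$, compute the list $\mathcal{T}_v$ of triangles of $G$ containing $v$. (2) If $G$ has a $\Delta$-extreme vertex $v$, set $S_1 = \{v\}$ and $S_2 = V(G)\setminus S_1$, and return $\{S_1,S_2\}$. (3) Otherwise, let $S_1$ be (the vertex set of) any triangle of $G$. (4) While there is a triangle $T$ of $G$ such that $1 \le |T \cap S_1| \le 2$, replace $S_1$ by $S_1 \cup T$. (5) If $S_1 \ne V(G)$, set $S_2 = V(G)\setminus S_1$ and return $\{S_1,S_2\}$. (6) Return $\emptyset$. *)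

theory Defs
  imports "Graph_Theory.Pair_Digraph"
begin

text \<open>
  A finite simple undirected graph is a \<^term>\<open>pair_graph\<close>: a finite symmetric loop-free digraph
  whose arcs are pairs of vertices. The edge \<open>uv\<close> is represented by the two arcs
  \<open>(u, v)\<close> and \<open>(v, u)\<close>.
\<close>

definition is_triangle :: "'a pair_pre_digraph \<Rightarrow> 'a set \<Rightarrow> bool" where
  "is_triangle G T \<longleftrightarrow>
     T \<subseteq> pverts G \<and> card T = 3 \<and> (\<forall>u\<in>T. \<forall>v\<in>T. u \<noteq> v \<longrightarrow> (u, v) \<in> parcs G)"

text \<open>
  In the next definition \<open>u\<close> and \<open>v\<close> are necessarily distinct, since a triangle has cardinality 3.
\<close>

definition triangle_convex :: "'a pair_pre_digraph \<Rightarrow> 'a set \<Rightarrow> bool" where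
  "triangle_convex G S \<longleftrightarrow>
     S \<subseteq> pverts G \<and> \<not> (\<exists>w \<in> pverts G - S. \<exists>u\<in>S. \<exists>v\<in>S. is_triangle G {w, u, v})"

definition triangle_convex_2_partition :: "'a pair_pre_digraph \<Rightarrow> 'a set set \<Rightarrow> bool" where
  "triangle_convex_2_partition G P \<longleftrightarrow>
     (\<exists>S1 S2. P = {S1, S2} \<and> S1 \<noteq> {} \<and> S2 \<noteq> {} \<and> S1 \<inter> S2 = {} \<and> S1 \<union> S2 = pverts G \<and>
        triangle_convex G S1 \<and> triangle_convex G S2)"

definition triangle_extreme :: "'a pair_pre_digraph \<Rightarrow> 'a \<Rightarrow> bool" where
  "triangle_extreme G u \<longleftrightarrow> u \<in> pverts G \<and> triangle_convex G (pverts G - {u})"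

text \<open>
  The algorithm makes arbitrary choices (of the order of the triangle lists, of the extreme
  vertex, of the initial triangle, and of the triangle in each loop iteration), so it is given as a
  nondeterministic transition system. A state records the control point together with the values
  computed so far: \<open>Init\<close> is the start, \<open>Listed Ts\<close> is reached once the triangle lists \<open>Ts v\<close> are
  known, \<open>NoExtreme Ts\<close> once the test for an extreme vertex has failed, \<open>Loop Ts S1\<close> is the head
  of the while loop, \<open>Exited Ts S1\<close> the point after the loop, and \<open>Return P\<close> is final with
  output \<open>P\<close>.
\<close>

datatype 'a state =
    Init
  | Listed "'a \<Rightarrow> 'a set list"
  | NoExtreme "'a \<Rightarrow> 'a set list"
  | Loop "'a \<Rightarrow> 'a set list" "'a set"
  | Exited "'a \<Rightarrow> 'a set list" "'a set"
  | Return "'a set set"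

inductive Convex2Partition_step :: "'a pair_pre_digraph \<Rightarrow> 'a state \<Rightarrow> 'a state \<Rightarrow> bool"
  for G :: "'a pair_pre_digraph" where
  compute_lists:
    "(\<And>v. v \<in> pverts G \<Longrightarrow> distinct (Ts v) \<and> set (Ts v) = {T. is_triangle G T \<and> v \<in> T}) \<Longrightarrow>
     Convex2Partition_step G Init (Listed Ts)"
| extreme:
    "triangle_extreme G v \<Longrightarrow>
     Convex2Partition_step G (Listed Ts) (Return {{v}, pverts G - {v}})"
| no_extreme:
    "\<not> (\<exists>v. triangle_extreme G v) \<Longrightarrow>
     Convex2Partition_step G (Listed Ts) (NoExtreme Ts)"
| initial_triangle:
    "is_triangle G T \<Longrightarrow>
     Convex2Partition_step G (NoExtreme Ts) (Loop Ts T)"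
| loop_body:
    "is_triangle G T \<Longrightarrow> 1 \<le> card (T \<inter> S1) \<Longrightarrow> card (T \<inter> S1) \<le> 2 \<Longrightarrow>
     Convex2Partition_step G (Loop Ts S1) (Loop Ts (S1 \<union> T))"
| loop_exit:
    "\<not> (\<exists>T. is_triangle G T \<and> 1 \<le> card (T \<inter> S1) \<and> card (T \<inter> S1) \<le> 2) \<Longrightarrow>
     Convex2Partition_step G (Loop Ts S1) (Exited Ts S1)"
| return_partition:
    "S1 \<noteq> pverts G \<Longrightarrow>
     Convex2Partition_step G (Exited Ts S1) (Return {S1, pverts G - S1})"
| return_empty:
    "S1 = pverts G \<Longrightarrow>
     Convex2Partition_step G (Exited Ts S1) (Return {})"

definition Convex2Partition_reaches :: "'a pair_pre_digraph \<Rightarrow> 'a state \<Rightarrow> bool" where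
  "Convex2Partition_reaches G s \<longleftrightarrow> (Convex2Partition_step G)\<^sup>*\<^sup>* Init s"

definition Convex2Partition_terminates :: "'a pair_pre_digraph \<Rightarrow> bool" where
  "Convex2Partition_terminates G \<longleftrightarrow>
     \<not> (\<exists>f :: nat \<Rightarrow> 'a state. f 0 = Init \<and> (\<forall>i. Convex2Partition_step G (f i) (f (Suc i))))"

text \<open>
  The algorithm never gets stuck before returning: a step that demands a choice
  always finds something to choose.
\<close>

definition Convex2Partition_progresses :: "'a pair_pre_digraph \<Rightarrow> bool" where
  "Convex2Partition_progresses G \<longleftrightarrow>
     (\<forall>s. Convex2Partition_reaches G s \<longrightarrow>
        (\<exists>P. s = Return P) \<or> (\<exists>s'. Convex2Partition_step G s s'))"

definition Convex2Partition_returns :: "'a pair_pre_digraph \<Rightarrow> 'a set set \<Rightarrow> bool" where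
  "Convex2Partition_returns G P \<longleftrightarrow> Convex2Partition_reaches G (Return P)"

end

theory Submission
  imports Defs
begin

text \<open>
  A triangle cannot be split between the two parts of a convex 2-partition, because the part holding
  at least two of its vertices must hold the third. Hence the set grown by the loop always stays
  inside one part of every convex 2-partition, and if it fills the whole vertex set there is none.
  Conversely, the loop stops only when no triangle is split between the set and its complement,
  which makes both of them convex.
\<close>

section \<open>Triangles against convex sets\<close>

lemma triangle_subset_of_convex:
  assumes "triangle_convex G S" "is_triangle G T" "2 \<le> card (T \<inter> S)"
  shows "T \<subseteq> S"
proof (rule ccontr)
  assume "\<not> T \<subseteq> S"
  then obtain w where w: "w \<in> T" "w \<notin> S" by blast
  have cT: "card T = 3" and TV: "T \<subseteq> pverts G"
    using assms(2) by (auto simp: is_triangle_def)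
  then have fT: "finite T" using card.infinite by fastforce
  \<comment> \<open>Two distinct vertices of \<open>T\<close> in \<open>S\<close>, together with
    \<open>w\<close>, exhaust the three vertices of \<open>T\<close>, so \<open>T\<close> is the
    configuration \<open>{w, u, v}\<close> that convexity of \<open>S\<close> forbids.\<close>
  obtain U where "U \<subseteq> T \<inter> S" "card U = 2"
    using obtain_subset_with_card_n[OF assms(3)] by blast
  then obtain u v where uv: "u \<in> T" "v \<in> T" "u \<in> S" "v \<in> S" "u \<noteq> v"
    by (auto simp: card_2_iff)
  have "w \<noteq> u" "w \<noteq> v" using uv w by blast+
  then have "card {w, u, v} = card T" using uv cT by simp
  then have "{w, u, v} = T"
    using card_subset_eq[OF fT, of "{w, u, v}"] uv w by blast
  then show False
    using assms(1,2) uv w TV unfolding triangle_convex_def by blast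
qed

text \<open>Pigeonhole: two of the three vertices of \<open>T\<close> lie in the same one of
  \<open>A\<close> and \<open>B\<close>, whose convexity then pulls in the third.\<close>

lemma triangle_in_part:
  assumes "triangle_convex G A" "triangle_convex G B" "A \<union> B = pverts G" "is_triangle G T"
  shows "T \<subseteq> A \<or> T \<subseteq> B"
proof -
  have T: "card T = 3" "T \<subseteq> pverts G"
    using assms(4) by (auto simp: is_triangle_def)
  then have "T = (T \<inter> A) \<union> (T \<inter> B)" using assms(3) by blast
  then have "3 \<le> card (T \<inter> A) + card (T \<inter> B)"
    using card_Un_le[of "T \<inter> A" "T \<inter> B"] T(1) by simp
  then have "2 \<le> card (T \<inter> A) \<or> 2 \<le> card (T \<inter> B)" by linarith
  then show ?thesis using triangle_subset_of_convex assms by metis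
qed

text \<open>A triangle refuting convexity of \<open>S\<close> has exactly one vertex outside
  \<open>S\<close>; one refuting convexity of the complement has exactly one vertex inside. Both
  would be split by \<open>S\<close>.\<close>

lemma triangle_convex_if_no_triangle_split:
  assumes "S \<subseteq> pverts G"
    and "\<And>T. is_triangle G T \<Longrightarrow> \<not> (1 \<le> card (T \<inter> S) \<and> card (T \<inter> S) \<le> 2)"
  shows "triangle_convex G S" "triangle_convex G (pverts G - S)"
proof -
  have False if "w \<in> pverts G - S" "u \<in> S" "v \<in> S" "is_triangle G {w, u, v}" for w u v
  proof -
    have "{w, u, v} \<inter> S = {u, v}" using that by auto
    \<comment> \<open>The intersection has one element if \<open>u = v\<close> and two otherwise;
      either count lies in the excluded range.\<close>
    then show False using assms(2)[OF that(4)] by (cases "u = v") simp_all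
  qed
  then show "triangle_convex G S" using assms(1) by (auto simp: triangle_convex_def)
  have False if "w \<in> S" "u \<notin> S" "v \<notin> S" "is_triangle G {w, u, v}" for w u v
  proof -
    have "{w, u, v} \<inter> S = {w}" using that by auto
    then show False using assms(2)[OF that(4)] by simp
  qed
  then show "triangle_convex G (pverts G - S)" by (auto simp: triangle_convex_def)
qed

lemma triangle_convex_singleton:
  assumes "v \<in> pverts G"
  shows "triangle_convex G {v}"
proof -
  have "\<not> is_triangle G {w, v}" for w
    by (cases "w = v") (simp_all add: is_triangle_def)
  then show ?thesis using assms by (simp add: triangle_convex_def)
qed

text \<open>Used in contrapositive form: once the test for an extreme vertex has failed, there is a
  triangle to start the loop with.\<close>

lemma triangle_extreme_if_no_triangle:
  assumes "v \<in> pverts G" "\<And>T. \<not> is_triangle G T"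
  shows "triangle_extreme G v"
  using assms by (simp add: triangle_extreme_def triangle_convex_def)

lemma triangle_extreme_2_partition:
  assumes "2 \<le> card (pverts G)" "triangle_extreme G v"
  shows "triangle_convex_2_partition G {{v}, pverts G - {v}}"
proof -
  have v: "v \<in> pverts G" "triangle_convex G (pverts G - {v})"
    using assms(2) by (auto simp: triangle_extreme_def)
  \<comment> \<open>Here the order being at least 2 enters.\<close>
  have "pverts G - {v} \<noteq> {}"
  proof
    assume "pverts G - {v} = {}"
    then have "pverts G = {v}" using v(1) by blast
    then show False using assms(1) by simp
  qed
  then show ?thesis
    unfolding triangle_convex_2_partition_def using v triangle_convex_singleton[OF v(1)]
    by (intro exI[of _ "{v}"] exI[of _ "pverts G - {v}"]) auto
qed

section \<open>Sets that no convex 2-partition separates\<close>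

text \<open>The loop invariant. Quantifying over all \<open>Q\<close> lets it be maintained without
  knowing whether a partition exists; the part \<open>A\<close> may depend on
  \<open>Q\<close>.\<close>

definition inside_every_2_partition :: "'a pair_pre_digraph \<Rightarrow> 'a set \<Rightarrow> bool" where
  "inside_every_2_partition G S \<longleftrightarrow> S \<noteq> {} \<and> S \<subseteq> pverts G \<and>
     (\<forall>Q. triangle_convex_2_partition G Q \<longrightarrow> (\<exists>A\<in>Q. S \<subseteq> A))"

lemma inside_every_2_partition_triangle:
  assumes "is_triangle G T"
  shows "inside_every_2_partition G T"
proof -
  have "T \<noteq> {}" "T \<subseteq> pverts G" using assms by (auto simp: is_triangle_def)
  moreover have "\<exists>A\<in>Q. T \<subseteq> A" if Q: "triangle_convex_2_partition G Q" for Q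
  proof -
    obtain A B where AB: "Q = {A, B}" "A \<union> B = pverts G" "triangle_convex G A" "triangle_convex G B"
      using Q unfolding triangle_convex_2_partition_def by metis
    then show ?thesis using triangle_in_part[OF AB(3,4,2) assms] by simp
  qed
  ultimately show ?thesis by (simp add: inside_every_2_partition_def)
qed

text \<open>The parts holding \<open>S\<close> and \<open>T\<close> share a vertex of
  \<open>S \<inter> T\<close>. Parts are disjoint, so they coincide.\<close>

lemma inside_every_2_partition_Un:
  assumes "inside_every_2_partition G S" "inside_every_2_partition G T" "S \<inter> T \<noteq> {}"
  shows "inside_every_2_partition G (S \<union> T)"
proof -
  have "\<exists>A\<in>Q. S \<union> T \<subseteq> A" if Q: "triangle_convex_2_partition G Q" for Q
  proof -
    obtain A B where AB: "A \<in> Q" "S \<subseteq> A" "B \<in> Q" "T \<subseteq> B"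
      using assms(1,2) Q unfolding inside_every_2_partition_def by meson
    then have "A \<inter> B \<noteq> {}" using assms(3) by blast
    then have "A = B" using AB Q unfolding triangle_convex_2_partition_def by blast
    then show ?thesis using AB by blast
  qed
  then show ?thesis using assms(1,2) by (simp add: inside_every_2_partition_def)
qed

lemma no_2_partition_if_inside_all:
  assumes "inside_every_2_partition G (pverts G)"
  shows "\<not> triangle_convex_2_partition G Q"
proof
  assume Q: "triangle_convex_2_partition G Q"
  then obtain A B where AB: "Q = {A, B}" "A \<union> B = pverts G" "A \<inter> B = {}" "A \<noteq> {}" "B \<noteq> {}"
    unfolding triangle_convex_2_partition_def by metis
  moreover have "pverts G \<subseteq> A \<or> pverts G \<subseteq> B"
    using assms Q AB(1) by (auto simp: inside_every_2_partition_def)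
  ultimately show False by blast
qed

section \<open>Invariant of the transition system\<close>

definition correct_output :: "'a pair_pre_digraph \<Rightarrow> 'a set set \<Rightarrow> bool" where
  "correct_output G P \<longleftrightarrow>
     (if \<exists>Q. triangle_convex_2_partition G Q then triangle_convex_2_partition G P else P = {})"

text \<open>The \<open>NoExtreme\<close> clause serves progress; the clauses for \<open>Loop\<close>
  and \<open>Exited\<close> carry what is needed to judge the output.\<close>

fun state_invariant :: "'a pair_pre_digraph \<Rightarrow> 'a state \<Rightarrow> bool" where
  "state_invariant G Init \<longleftrightarrow> True"
| "state_invariant G (Listed Ts) \<longleftrightarrow> True"
| "state_invariant G (NoExtreme Ts) \<longleftrightarrow> \<not> (\<exists>v. triangle_extreme G v)"
| "state_invariant G (Loop Ts S) \<longleftrightarrow> inside_every_2_partition G S"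
| "state_invariant G (Exited Ts S) \<longleftrightarrow> inside_every_2_partition G S \<and>
     \<not> (\<exists>T. is_triangle G T \<and> 1 \<le> card (T \<inter> S) \<and> card (T \<inter> S) \<le> 2)"
| "state_invariant G (Return P) \<longleftrightarrow> correct_output G P"

lemma state_invariant_step:
  assumes "Convex2Partition_step G s s'" "state_invariant G s" "2 \<le> card (pverts G)"
  shows "state_invariant G s'"
  using assms(1)
proof cases
  case (extreme v Ts)
  then show ?thesis
    using triangle_extreme_2_partition[OF assms(3)] by (auto simp: correct_output_def)
next
  case (initial_triangle T Ts)
  then show ?thesis using inside_every_2_partition_triangle by simp
next
  case (loop_body T S Ts)
  then have "S \<inter> T \<noteq> {}" by (auto simp: Int_commute)
  then show ?thesis
    using loop_body assms(2) inside_every_2_partition_triangle[of G T]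
      inside_every_2_partition_Un[of G S T] by simp
next
  case (return_partition S Ts)
  then have S: "S \<noteq> {}" "S \<subseteq> pverts G"
    using assms(2) by (auto simp: inside_every_2_partition_def)
  have "triangle_convex G S" "triangle_convex G (pverts G - S)"
    using triangle_convex_if_no_triangle_split[OF S(2)] return_partition assms(2) by auto
  then have "triangle_convex_2_partition G {S, pverts G - S}"
    unfolding triangle_convex_2_partition_def using S return_partition
    by (intro exI[of _ S] exI[of _ "pverts G - S"]) auto
  then show ?thesis using return_partition by (auto simp: correct_output_def)
next
  case (return_empty S Ts)
  then show ?thesis
    using assms(2) no_2_partition_if_inside_all by (auto simp: correct_output_def)
qed (use assms(2) in auto)

lemma state_invariant_reaches:
  assumes "Convex2Partition_reaches G s" "2 \<le> card (pverts G)"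
  shows "state_invariant G s"
proof -
  have "(Convex2Partition_step G)\<^sup>*\<^sup>* Init s"
    using assms(1) by (simp add: Convex2Partition_reaches_def)
  then show ?thesis
    by induction (auto intro: state_invariant_step[OF _ _ assms(2)])
qed

section \<open>Progress and termination\<close>

lemma triangle_lists_exist:
  assumes "finite (pverts G)"
  shows "\<exists>Ts. \<forall>v. distinct (Ts v) \<and> set (Ts v) = {T. is_triangle G T \<and> v \<in> T}"
proof -
  have "{T. is_triangle G T \<and> v \<in> T} \<subseteq> Pow (pverts G)" for v
    by (auto simp: is_triangle_def)
  then have "finite {T. is_triangle G T \<and> v \<in> T}" for v
    using assms by (meson finite_Pow_iff finite_subset)
  then show ?thesis by (intro choice allI) (metis finite_distinct_list)
qed

text \<open>Most states offer a guard and its negation, so one step always applies. Only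
  \<open>Init\<close> and \<open>NoExtreme\<close> require an object to exist: the triangle lists
  and an initial triangle.\<close>

lemma step_exists:
  assumes "finite (pverts G)" "pverts G \<noteq> {}" "state_invariant G s"
  shows "(\<exists>P. s = Return P) \<or> (\<exists>s'. Convex2Partition_step G s s')"
proof (cases s)
  case Init
  then show ?thesis
    using triangle_lists_exist[OF assms(1)] by (metis compute_lists)
next
  case (Listed Ts)
  then show ?thesis by (metis extreme no_extreme)
next
  case (NoExtreme Ts)
  then obtain T where "is_triangle G T"
    using assms(2,3) triangle_extreme_if_no_triangle[of _ G] by auto
  then show ?thesis using NoExtreme initial_triangle by blast
next
  case (Loop Ts S)
  then show ?thesis by (metis loop_body loop_exit)
next
  case (Exited Ts S)
  then show ?thesis by (metis return_partition return_empty)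
qed simp

text \<open>In the loop the rank counts the vertices not yet absorbed. The offset 2 keeps
  \<open>Loop\<close> above \<open>Exited\<close> even when none is left.\<close>

fun state_rank :: "'a pair_pre_digraph \<Rightarrow> 'a state \<Rightarrow> nat" where
  "state_rank G Init = card (pverts G) + 4"
| "state_rank G (Listed Ts) = card (pverts G) + 3"
| "state_rank G (NoExtreme Ts) = card (pverts G) + 2"
| "state_rank G (Loop Ts S) = card (pverts G - S) + 2"
| "state_rank G (Exited Ts S) = 1"
| "state_rank G (Return P) = 0"

lemma state_rank_step:
  assumes "Convex2Partition_step G s s'" "finite (pverts G)"
  shows "state_rank G s' < state_rank G s"
  using assms(1)
proof cases
  case (initial_triangle T Ts)
  then have "T \<noteq> {}" "T \<subseteq> pverts G" by (auto simp: is_triangle_def)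
  \<comment> \<open>\<open>NoExtreme\<close> and \<open>Loop\<close> share the offset 2, so the
    strict decrease comes from the vertices of \<open>T\<close>.\<close>
  then have "pverts G - T \<subset> pverts G" by blast
  then show ?thesis using initial_triangle psubset_card_mono[OF assms(2)] by simp
next
  case (loop_body T S Ts)
  then have T: "card T = 3" "T \<subseteq> pverts G" by (auto simp: is_triangle_def)
  \<comment> \<open>If \<open>T\<close> were inside \<open>S\<close>, the intersection would have
    three elements, against the loop guard. So each iteration adds a vertex.\<close>
  then have "\<not> T \<subseteq> S" using loop_body by (auto simp: Int_absorb2)
  then have "pverts G - (S \<union> T) \<subset> pverts G - S" using T(2) by blast
  then show ?thesis using loop_body psubset_card_mono[of "pverts G - S"] assms(2) by simp
qed auto

lemma Convex2Partition_terminates_if_finite: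
  assumes "finite (pverts G)"
  shows "Convex2Partition_terminates G"
proof -
  have False if "\<And>i. Convex2Partition_step G (f i) (f (Suc i))" for f :: "nat \<Rightarrow> 'a state"
  proof (rule wf_no_infinite_down_chainE[OF wf_measure[of "state_rank G"], of f])
    fix i
    assume "(f (Suc i), f i) \<notin> measure (state_rank G)"
    then show False using state_rank_step[OF that assms] by simp
  qed
  then show ?thesis unfolding Convex2Partition_terminates_def by blast
qed

text \<open>Progress supplies a step from any reachable state that is not final, and the rank drops,
  so induction on the rank ends at a \<open>Return\<close>.\<close>

lemma Convex2Partition_returns_if_reaches:
  assumes "finite (pverts G)" "Convex2Partition_progresses G" "Convex2Partition_reaches G s"
  shows "\<exists>P. Convex2Partition_returns G P"
  using assms(3)
proof (induction "state_rank G s" arbitrary: s rule: less_induct)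
  case less
  consider P where "s = Return P" | s' where "Convex2Partition_step G s s'"
    using assms(2) less.prems by (auto simp: Convex2Partition_progresses_def)
  then show ?case
  proof cases
    case 1
    then show ?thesis using less.prems by (auto simp: Convex2Partition_returns_def)
  next
    case 2
    then have "Convex2Partition_reaches G s'"
      using less.prems unfolding Convex2Partition_reaches_def
      by (meson rtranclp.rtrancl_into_rtrancl)
    then show ?thesis using less.hyps state_rank_step[OF 2 assms(1)] by blast
  qed
qed

theorem theorem5:
  fixes G :: "'a pair_pre_digraph"
  assumes "pair_graph G"
    and "card (pverts G) \<ge> 2"
  shows "Convex2Partition_terminates G \<and> Convex2Partition_progresses G \<and>
    (\<exists>P. Convex2Partition_returns G P) \<and>
    (\<forall>P. Convex2Partition_returns G P \<longrightarrow>
       (if \<exists>Q. triangle_convex_2_partition G Q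
        then triangle_convex_2_partition G P
        else P = {}))"
proof -
  \<comment> \<open>Infinite sets and the empty set both have \<open>card\<close> equal to 0, so the
    bound on the order excludes both.\<close>
  have fin: "finite (pverts G)" and ne: "pverts G \<noteq> {}"
    using assms(2) card.infinite by fastforce+
  have prog: "Convex2Partition_progresses G"
    unfolding Convex2Partition_progresses_def
    using step_exists[OF fin ne] state_invariant_reaches[OF _ assms(2)] by blast
  have "Convex2Partition_reaches G Init" by (simp add: Convex2Partition_reaches_def)
  then have ret: "\<exists>P. Convex2Partition_returns G P"
    by (rule Convex2Partition_returns_if_reaches[OF fin prog])
  have "correct_output G P" if "Convex2Partition_returns G P" for P
    using state_invariant_reaches[OF _ assms(2), of "Return P"] that
    by (simp add: Convex2Partition_returns_def)
  then show ?thesis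
    using Convex2Partition_terminates_if_finite[OF fin] prog ret
    unfolding correct_output_def by blast
qed

end
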